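(* Let $\{G_n^*(x)\}$ be a generalized Fibonacci polynomial sequence of Lucas type, and let $m,n$ be positive integers. Then $$\gcd(G_m^*(x),G_n^*(x))=\begin{cases} G^*_{\gcd(m,n)}(x) & \text{if } E_2(m)=E_2(n),\\ \gcd\big(G^*_{\gcd(m,n)}(x),G_0^*(x)\big) & \text{otherwise.}\end{cases}$$
   Context: All polynomials lie in $\mathbb{Z}[x]$ and $\gcd$ denotes the greatest common divisor in $\mathbb{Z}[x]$ (determined up to sign). A generalized Fibonacci polynomial (GFP) sequence $\{G_n(x)\}_{n\ge0}$ is given by $G_0(x)=p_0(x)$, $G_1(x)=p_1(x)$ and $G_n(x)=d(x)G_{n-1}(x)+g(x)G_{n-2}(x)$ for $n\ge 2$, where $p_0(x)$ is a constant and $p_1(x),d(x),g(x)$ are nonzero polynomials in $\mathbb{Z}[x]$ with $\gcd(d(x),g(x))=1$; as in the paper it is assumed that $d(x)^2+4g(x)>0$. Let $a,b$ be the roots of $z^2-d(x)z-g(x)=0$. The sequence is of Lucas type if $p_0\ne 0$, $2p_1(x)=p_0\,d(x)$, $|p_0|\in\{1,2\}$, and $\gcd(p_0,p_1(x))=\gcd(p_0,d(x))=\gcd(p_0,g(x))=1$; then, with $\alpha=2/p_0$, $G_n=(a^n+b^n)/\alpha$, and such a sequence is denoted $G_n^*$. For a positive integer $n$, $E_2(n)$ denotes the largest integer $k$ with $2^k\mid n$. *)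

theory Defs
  imports "HOL-Computational_Algebra.Computational_Algebra"
begin

fun gfp_seq :: "int \<Rightarrow> int poly \<Rightarrow> int poly \<Rightarrow> int poly \<Rightarrow> nat \<Rightarrow> int poly" where
  "gfp_seq p0 p1 d g 0 = [:p0:]"
| "gfp_seq p0 p1 d g (Suc 0) = p1"
| "gfp_seq p0 p1 d g (Suc (Suc n)) =
     d * gfp_seq p0 p1 d g (Suc n) + g * gfp_seq p0 p1 d g n"

text \<open>
  The inequality below is in the library's order on \<open>int poly\<close>: \<open>0 < f\<close> means that the leading
  coefficient of \<open>f\<close> is positive, i.e. \<open>f(x) > 0\<close> for all large real \<open>x\<close>. Positivity at every real
  \<open>x\<close> would be a stronger hypothesis, excluding e.g. the Chebyshev polynomials
  (\<open>d = 2x\<close>, \<open>g = -1\<close>) and the Jacobsthal--Lucas polynomials (\<open>d = 1\<close>, \<open>g = 2x\<close>).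
\<close>
definition is_gfp :: "int \<Rightarrow> int poly \<Rightarrow> int poly \<Rightarrow> int poly \<Rightarrow> bool" where
  "is_gfp p0 p1 d g \<longleftrightarrow>
     p1 \<noteq> 0 \<and> d \<noteq> 0 \<and> g \<noteq> 0 \<and> gcd d g = 1 \<and> d\<^sup>2 + 4 * g > 0"

definition is_gfp_lucas :: "int \<Rightarrow> int poly \<Rightarrow> int poly \<Rightarrow> int poly \<Rightarrow> bool" where
  "is_gfp_lucas p0 p1 d g \<longleftrightarrow>
     is_gfp p0 p1 d g \<and> p0 \<noteq> 0 \<and> 2 * p1 = [:p0:] * d \<and> \<bar>p0\<bar> \<in> {1, 2} \<and>
     gcd [:p0:] p1 = 1 \<and> gcd [:p0:] d = 1 \<and> gcd [:p0:] g = 1"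

text \<open>
  A gcd in \<open>\<int>[x]\<close> is determined up to sign. The library's \<open>gcd\<close> on \<open>int poly\<close> returns the
  representative with nonnegative leading coefficient, so "the gcd is \<open>f\<close>" is expressed by
  equality with \<open>normalize f\<close>.
\<close>

end

theory Submission
  imports Defs
begin

text \<open>
  Put \<open>\<alpha> = 2/p\<^sub>0\<close>, an integer. The product formula
  \<open>\<alpha> G(m+k) G(m) = G(2m+k) + (-g)^m G(k)\<close> and the coprimality of every \<open>G(n)\<close> with \<open>g\<close> give
  \<open>gcd (G m) (G n) = gcd (G m) (G \<bar>n - 2m\<bar>)\<close> for \<open>m \<le> n\<close>. Replacing \<open>(m, n)\<close> by
  \<open>(m, \<bar>n - 2m\<bar>)\<close> preserves \<open>D = gcd m n\<close> and the parities of \<open>m/D\<close> and \<open>n/D\<close>. This descent stops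
  at \<open>(D, D)\<close> if both quotients are odd, which means that \<open>m\<close> and \<open>n\<close> have the same 2-adic
  valuation, and at \<open>(D, 0)\<close> otherwise.
\<close>

text \<open>As \<open>p0\<close> is one of 1, -1, 2, -2, it divides 2; cancelling it from
  \<open>2 * p1 = [:p0:] * d\<close> gives \<open>d\<close>.\<close>

lemma gfp_lucas_alpha:
  assumes "is_gfp_lucas p0 p1 d g"
  obtains \<alpha> :: "int poly" where "\<alpha> * [:p0:] = 2" and "d = \<alpha> * p1"
proof -
  have eq: "2 * p1 = [:p0:] * d" and "p0 \<noteq> 0" and p0: "p0 \<in> {1, -1, 2, -2}"
    using assms by (auto simp: is_gfp_lucas_def)
  define \<alpha> where "\<alpha> = [:2 div p0:]"
  have \<alpha>: "\<alpha> * [:p0:] = 2"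
    using p0 by (auto simp: \<alpha>_def numeral_poly)
  have "[:p0:] * d = [:p0:] * (\<alpha> * p1)"
    using eq by (simp only: \<alpha>[symmetric] mult_ac)
  with \<open>p0 \<noteq> 0\<close> have "d = \<alpha> * p1" by (metis mult_cancel_left pCons_eq_0_iff)
  with \<alpha> show thesis by (rule that)
qed

text \<open>In terms of the roots, \<open>\<alpha> * G n = a^n + b^n\<close> and
  \<open>a * b = - g\<close>, so this expands a product of two such sums. Induction avoids the
  roots; \<open>k\<close> is arbitrary because the step shifts it by 1 and 2.\<close>

lemma gfp_product_formula:
  fixes \<alpha> :: "int poly"
  assumes "\<alpha> * [:p0:] = 2" and "d = \<alpha> * p1"
  shows "\<alpha> * gfp_seq p0 p1 d g (m + k) * gfp_seq p0 p1 d g m =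
    gfp_seq p0 p1 d g (2 * m + k) + (- g) ^ m * gfp_seq p0 p1 d g k"
proof (induction m arbitrary: k rule: induct_nat_012)
  case 0
  have "\<alpha> * gfp_seq p0 p1 d g k * [:p0:] = (\<alpha> * [:p0:]) * gfp_seq p0 p1 d g k"
    by (simp only: mult_ac)
  then show ?case by (simp only: assms(1)) simp
next
  case 1
  have "\<alpha> * gfp_seq p0 p1 d g (Suc k) * p1 = d * gfp_seq p0 p1 d g (Suc k)"
    by (simp add: assms(2))
  then show ?case by simp
next
  case (ge2 m)
  let ?G = "gfp_seq p0 p1 d g"
  have "\<alpha> * ?G (Suc (Suc m) + k) * ?G (Suc (Suc m)) =
      \<alpha> * ?G (Suc (Suc m) + k) * (d * ?G (Suc m) + g * ?G m)"
    by (simp only: gfp_seq.simps(3))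
  also have "\<dots> =
      d * (\<alpha> * ?G (Suc m + Suc k) * ?G (Suc m)) + g * (\<alpha> * ?G (m + Suc (Suc k)) * ?G m)"
    by (simp only: add_Suc add_Suc_right distrib_left mult.assoc mult.left_commute)
  also have "\<dots> = d * (?G (2 * Suc m + Suc k) + (- g) ^ Suc m * ?G (Suc k)) +
      g * (?G (2 * m + Suc (Suc k)) + (- g) ^ m * (d * ?G (Suc k) + g * ?G k))"
    by (simp only: ge2 gfp_seq.simps(3))
  \<comment> \<open>The terms in \<open>?G (Suc k)\<close> cancel, because
    \<open>(- g) ^ Suc m = - g * (- g) ^ m\<close>.\<close>
  also have "\<dots> = (d * ?G (2 * Suc m + Suc k) + g * ?G (2 * m + Suc (Suc k))) +
      (- g) ^ Suc (Suc m) * ?G k"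
    by (simp only: power_Suc) algebra
  also have "d * ?G (2 * Suc m + Suc k) + g * ?G (2 * m + Suc (Suc k)) =
      ?G (2 * Suc (Suc m) + k)"
    by (simp only: mult_Suc_right add_Suc add_Suc_right add_2_eq_Suc gfp_seq.simps(3))
  finally show ?case .
qed

text \<open>Modulo \<open>g\<close> the recurrence multiplies by \<open>d\<close>, which is coprime
  to \<open>g\<close>; index 1 follows from \<open>p1\<close> dividing \<open>d\<close>.\<close>

lemma gfp_lucas_coprime_g:
  assumes "is_gfp_lucas p0 p1 d g"
  shows "coprime (gfp_seq p0 p1 d g n) g"
proof (induction n rule: induct_nat_012)
  case 0
  then show ?case using assms by (simp add: is_gfp_lucas_def coprime_iff_gcd_eq_1)
next
  case 1
  obtain \<alpha> where "d = \<alpha> * p1" using gfp_lucas_alpha[OF assms] by blast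
  moreover have "coprime d g"
    using assms by (simp add: is_gfp_lucas_def is_gfp_def coprime_iff_gcd_eq_1)
  ultimately show ?case by simp
next
  case (ge2 n)
  have "coprime d g"
    using assms by (simp add: is_gfp_lucas_def is_gfp_def coprime_iff_gcd_eq_1)
  with ge2(2) have "coprime (d * gfp_seq p0 p1 d g (Suc n)) g" by simp
  then show ?case
    by (simp add: coprime_iff_gcd_eq_1 gcd.commute[of _ g] gcd_add_mult[of g] mult.commute[of g]
        add.commute)
qed

lemma gcd_gfp_lucas_reflect:
  assumes "is_gfp_lucas p0 p1 d g" and "m \<le> n"
  shows "gcd (gfp_seq p0 p1 d g m) (gfp_seq p0 p1 d g n) =
    gcd (gfp_seq p0 p1 d g m) (gfp_seq p0 p1 d g (nat \<bar>int n - 2 * int m\<bar>))"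
proof -
  let ?G = "gfp_seq p0 p1 d g"
  obtain \<alpha> where \<alpha>: "\<alpha> * [:p0:] = 2" "d = \<alpha> * p1"
    using gfp_lucas_alpha[OF assms(1)] .
  define j where "j = nat \<bar>int n - 2 * int m\<bar>"
  have "\<exists>c l. ?G n = c * ?G m + (- g) ^ l * (- ?G j)"
  proof (cases "2 * m \<le> n")
    case True
    then have "n = 2 * m + j" by (simp add: j_def)
    then have "?G n = (\<alpha> * ?G (m + j)) * ?G m + (- g) ^ m * (- ?G j)"
      using gfp_product_formula[OF \<alpha>, of g m j] by simp
    then show ?thesis by blast
  next
    case False
    \<comment> \<open>Here \<open>j = 2 * m - n\<close>, so the factor \<open>?G m\<close> is now
      the one with the larger index \<open>k + j\<close> in the product formula.\<close>
    define k where "k = n - m"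
    have n: "n = 2 * k + j" and m: "m = k + j"
      using False assms(2) by (auto simp: j_def k_def)
    have "?G n = (\<alpha> * ?G k) * ?G m + (- g) ^ k * (- ?G j)"
      using gfp_product_formula[OF \<alpha>, of g k j] by (simp add: n m mult_ac)
    then show ?thesis by blast
  qed
  then obtain c l where c: "?G n = c * ?G m + (- g) ^ l * (- ?G j)" by blast
  have "coprime (?G m) ((- g) ^ l)"
    using gfp_lucas_coprime_g[OF assms(1)] by simp
  then have "gcd (?G m) ((- g) ^ l * (- ?G j)) = gcd (?G m) (- ?G j)"
    by (rule gcd_mult_right_left_cancel)
  then show ?thesis
    unfolding c gcd_add_mult by (simp only: gcd_neg2 j_def)
qed

lemma gcd_nat_reflect:
  fixes m n :: nat
  shows "gcd m (nat \<bar>int n - 2 * int m\<bar>) = gcd m n"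
proof -
  have "int (gcd m (nat \<bar>int n - 2 * int m\<bar>)) = gcd (int m) ((- 2) * int m + int n)"
    by (simp flip: gcd_int_int_eq)
  also have "\<dots> = int (gcd m n)"
    by (simp only: gcd_add_mult gcd_int_int_eq)
  finally show ?thesis by simp
qed

text \<open>The quotient by \<open>D\<close> changes by the even number \<open>2 * (m div D)\<close>
  and possibly its sign.\<close>

lemma even_div_reflect:
  fixes m n D :: nat
  assumes "D dvd m" and "D dvd n"
  shows "even (nat \<bar>int n - 2 * int m\<bar> div D) \<longleftrightarrow> even (n div D)"
proof (cases "D = 0")
  case False
  obtain a b where ab: "m = D * a" "n = D * b"
    using assms by (auto elim!: dvdE)
  have "int n - 2 * int m = int D * (int b - 2 * int a)"
    by (simp add: ab algebra_simps)
  then have "nat \<bar>int n - 2 * int m\<bar> = D * nat \<bar>int b - 2 * int a\<bar>"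
    by (simp add: abs_mult nat_mult_distrib)
  then show ?thesis
    using False by (simp add: ab even_nat_iff)
qed simp

text \<open>Parities of the quotients, unlike \<open>multiplicity 2\<close>, give the right case at
  index 0 too, where the descent may end.\<close>

lemma gcd_gfp_lucas_parity:
  assumes "is_gfp_lucas p0 p1 d g"
  shows "gcd (gfp_seq p0 p1 d g m) (gfp_seq p0 p1 d g n) =
    (if odd (m div gcd m n) \<and> odd (n div gcd m n)
     then normalize (gfp_seq p0 p1 d g (gcd m n))
     else gcd (gfp_seq p0 p1 d g (gcd m n)) (gfp_seq p0 p1 d g 0))"
proof (induction "m + n" arbitrary: m n rule: less_induct)
  case less
  let ?G = "gfp_seq p0 p1 d g"
  let ?P = "\<lambda>m n. gcd (?G m) (?G n) =
    (if odd (m div gcd m n) \<and> odd (n div gcd m n) then normalize (?G (gcd m n))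
     else gcd (?G (gcd m n)) (?G 0))"
  have step: "?P m' n'" if le: "m' \<le> n'" and sum: "m' + n' = m + n" for m' n'
  proof -
    consider "m' = 0" | "m' > 0" "m' = n'" | "m' > 0" "m' < n'" using le by linarith
    then show ?thesis
    proof cases
      case 1
      then show ?thesis by (simp add: gcd.commute)
    next
      case 2
      then show ?thesis by simp
    next
      case 3
      define j where "j = nat \<bar>int n' - 2 * int m'\<bar>"
      \<comment> \<open>Both \<open>n' - 2 * m'\<close> and \<open>2 * m' - n'\<close> are below
        \<open>n'\<close>, since \<open>0 < m' < n'\<close>.\<close>
      have "j < n'" using 3 by (auto simp: j_def)
      then have "?P m' j" using less[of m' j] sum by simp
      moreover have "gcd m' j = gcd m' n'"
        unfolding j_def by (rule gcd_nat_reflect)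
      moreover have "even (j div gcd m' n') \<longleftrightarrow> even (n' div gcd m' n')"
        unfolding j_def by (rule even_div_reflect) auto
      ultimately show ?thesis
        using gcd_gfp_lucas_reflect[OF assms le] by (simp add: j_def)
    qed
  qed
  show ?case
  proof (cases "m \<le> n")
    case True
    then show ?thesis using step by blast
  next
    case False
    then have "?P n m" using step[of n m] by simp
    then show ?thesis by (simp add: gcd.commute conj_commute)
  qed
qed

text \<open>After removing the gcd the quotients are coprime, so at most one is even; their
  valuations agree only if both vanish.\<close>

lemma multiplicity_2_eq_iff_odd_div_gcd:
  fixes m n :: nat
  assumes "m > 0" and "n > 0"
  shows "multiplicity 2 m = multiplicity 2 n \<longleftrightarrow> odd (m div gcd m n) \<and> odd (n div gcd m n)"
proof -
  define D where "D = gcd m n"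
  define a b where "a = m div D" and "b = n div D"
  have D: "D > 0" using assms by (simp add: D_def)
  have m: "m = D * a" and n: "n = D * b" by (simp_all add: a_def b_def D_def)
  have ab: "a > 0" "b > 0" using assms m n by (auto intro: gr0I)
  have "coprime a b"
    unfolding a_def b_def D_def using assms by (intro div_gcd_coprime) simp
  then have nand: "odd a \<or> odd b" by (auto dest: coprime_common_divisor[of a b 2])
  have mult: "multiplicity 2 (D * c) = multiplicity 2 D + multiplicity 2 c" if "c > 0" for c
    using D that by (intro prime_elem_multiplicity_mult_distrib) auto
  have zero: "multiplicity 2 c = 0 \<longleftrightarrow> odd c" if "c > 0" for c :: nat
    using that by (simp add: multiplicity_eq_zero_iff)
  have "multiplicity 2 m = multiplicity 2 n \<longleftrightarrow> multiplicity 2 a = multiplicity 2 b"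
    using ab by (simp add: m n mult)
  also have "\<dots> \<longleftrightarrow> odd a \<and> odd b"
    using nand zero[OF ab(1)] zero[OF ab(2)] by metis
  finally show ?thesis by (simp add: a_def b_def D_def)
qed

theorem theorem15:
  fixes p0 :: int and p1 d g :: "int poly" and m n :: nat
  assumes "is_gfp_lucas p0 p1 d g"
    and "m > 0" and "n > 0"
  shows "gcd (gfp_seq p0 p1 d g m) (gfp_seq p0 p1 d g n) =
    (if multiplicity 2 m = multiplicity 2 n
     then normalize (gfp_seq p0 p1 d g (gcd m n))
     else gcd (gfp_seq p0 p1 d g (gcd m n)) (gfp_seq p0 p1 d g 0))"
  unfolding multiplicity_2_eq_iff_odd_div_gcd[OF assms(2,3)]
  by (rule gcd_gfp_lucas_parity[OF assms(1)])

end
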